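(* Let $n\ge 1$, let $p_1,\dots,p_n\in[0,1]$ with $\lambda=p_1+\dots+p_n>0$, put $\lambda_2=p_1^2+\dots+p_n^2$, let $W=X_1+\dots+X_n$ where $X_1,\dots,X_n$ are independent Bernoulli random variables with $\mathbb{P}\{X_j=1\}=p_j$, $\mathbb{P}\{X_j=0\}=1-p_j$, and let $Z$ be a Poisson random variable with parameter $\lambda$. For integers $k\ge 0$ put $\Delta_k=\mathbb{P}\{W=k\}-\mathbb{P}\{Z=k\}$. Then $$|\Delta_0|\le 3\lambda_2\,e^{-\lambda},\qquad |\Delta_k|\le 3\lambda_2\quad\text{for all integers }k\ge 1 .$$ Moreover, for every integer $k\ge 1$, putting $\rho=(\lambda-\lambda_2)\min\{\frac{k}{\lambda},\frac{\lambda}{k}\}$, $$|\Delta_k|\le 7\sqrt{k}\,\Big(\frac{k-\lambda}{\lambda}\Big)^2\lambda_2\,\min\{1,\rho^{-1/2}\}\,\mathbb{P}\{Z=k\}+21\,k^{3/2}\,\frac{\lambda_2}{\lambda}\,\min\{1,\rho^{-3/2}\}\,\mathbb{P}\{Z=k\}.$$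
   Context: The Poisson law with parameter $\lambda$ is $\mathbb{P}\{Z=k\}=\frac{\lambda^k}{k!}e^{-\lambda}$, $k=0,1,2,\dots$. When $\rho=0$ (which can occur only if $\lambda_2=\lambda$), $\rho^{-1/2}$ and $\rho^{-3/2}$ are interpreted as $+\infty$, so that the minima equal $1$. *)

theory Defs
  imports "HOL-Probability.Probability"
begin

text \<open>\<open>min {1, x powr -a}\<close> for \<open>x \<ge> 0\<close> and \<open>a > 0\<close>, where \<open>x powr -a\<close> is read as \<open>+\<infinity>\<close> at
  \<open>x = 0\<close>.  The case distinction is needed because HOL has \<open>0 powr -a = 0\<close>.\<close>

definition min_one_neg_powr :: "real \<Rightarrow> real \<Rightarrow> real" where
  "min_one_neg_powr x a = (if x = 0 then 1 else min 1 (x powr (- a)))"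

end

theory Submission
  imports Defs "HOL-Complex_Analysis.Complex_Analysis"
begin

text \<open>
  \<open>\<Delta>\<^sub>k\<close> is the \<open>k\<close>-th Taylor coefficient of \<open>\<Prod>(1 + p\<^sub>j(w - 1)) - exp(\<lambda>(w - 1))\<close>, so it is
  bounded by the mean of the modulus over a circle \<open>|w| = r\<close>, divided by \<open>r^k\<close>. Telescoping the
  difference of the two products reduces that modulus to the factors: at argument \<open>2\<pi>t\<close> each factor of
  either product is at most \<open>exp(p\<^sub>j(r - 1) - 2p\<^sub>j(1 - p\<^sub>j) min(r, 1/r) sin\<^sup>2(\<pi>t))\<close>, and relative to this
  bound corresponding factors differ by \<open>O(p\<^sub>j\<^sup>2|w - 1|\<^sup>2)\<close>, where
  \<open>|w - 1|\<^sup>2 = (r - 1)\<^sup>2 + 4r sin\<^sup>2(\<pi>t)\<close>. The integrals left over are dominated by Gaussian ones and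
  give the powers of \<open>\<rho>\<close>. The radius \<open>r = 1\<close> yields the uniform bound; the saddle point \<open>r = k/\<lambda>\<close>,
  combined with \<open>k! \<le> e \<surd>k (k/e)^k\<close>, yields the local one. For \<open>k = 0\<close> the products are compared
  directly.
\<close>

section \<open>Estimates for the exponential and the factorial\<close>

text \<open>Taylor's formula with integral remainder: \<open>exp u - 1 - u\<close> is the integral
  of \<open>(1 - t) * u^2 * exp (t * u)\<close> over [0, 1]. The maximum covers both signs of
  \<open>Re u\<close>, and the weight \<open>1 - t\<close> gives the factor 1/2.\<close>

lemma norm_exp_minus_one_minus_le:
  fixes u :: complex
  shows "norm (exp u - 1 - u) \<le> (norm u)\<^sup>2 / 2 * max 1 (exp (Re u))"
proof -
  define M where "M = (norm u)\<^sup>2 * max 1 (exp (Re u))"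
  \<comment> \<open>The antiderivative is
    \<open>(1 - t) * u * exp (t * u) + exp (t * u)\<close>.\<close>
  have "((\<lambda>t. of_real (1 - t) * u\<^sup>2 * exp (of_real t * u)) has_integral
      (of_real (1 - 1) * u * exp (of_real 1 * u) + exp (of_real 1 * u))
      - (of_real (1 - 0) * u * exp (of_real 0 * u) + exp (of_real 0 * u))) {0..1}"
    by (rule fundamental_theorem_of_calculus)
       (auto intro!: derivative_eq_intros has_vector_derivative_real_field
             simp: algebra_simps power2_eq_square)
  then have 1: "((\<lambda>t. of_real (1 - t) * u\<^sup>2 * exp (of_real t * u)) has_integral (exp u - 1 - u)) {0..1}"
    by (simp add: algebra_simps)
  have "((\<lambda>t::real. M * (1 - t)) has_integral M * (1 - 1 ^ 2 / 2) - M * (0 - 0 ^ 2 / 2)) {0..1}"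
    by (rule fundamental_theorem_of_calculus)
       (auto intro!: derivative_eq_intros
             simp: has_real_derivative_iff_has_vector_derivative[symmetric] algebra_simps)
  then have 2: "((\<lambda>t::real. M * (1 - t)) has_integral M / 2) {0..1}" by simp
  have le: "norm (of_real (1 - t) * u\<^sup>2 * exp (of_real t * u)) \<le> M * (1 - t)"
    if t: "t \<in> {0..1}" for t
  proof -
    have "exp (t * Re u) \<le> max 1 (exp (Re u))"
    proof (cases "Re u \<le> 0")
      case True
      then have "t * Re u \<le> 0" using t by (simp add: mult_nonneg_nonpos)
      then show ?thesis by (simp add: le_max_iff_disj)
    next
      case False
      then have "t * Re u \<le> 1 * Re u" using t by (intro mult_right_mono) auto
      then show ?thesis by (simp add: le_max_iff_disj)
    qed
    then have "(1 - t) * (norm u)\<^sup>2 * exp (t * Re u) \<le> (1 - t) * (norm u)\<^sup>2 * max 1 (exp (Re u))"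
      using t by (intro mult_left_mono) auto
    moreover have "norm (of_real (1 - t) * u\<^sup>2 * exp (of_real t * u)) = (1 - t) * (norm u)\<^sup>2 * exp (t * Re u)"
      using t by (simp add: norm_mult norm_power del: of_real_diff)
    ultimately show ?thesis by (simp add: M_def mult_ac)
  qed
  have "norm (integral {0..1} (\<lambda>t. of_real (1 - t) * u\<^sup>2 * exp (of_real t * u)))
      \<le> integral {0..1} (\<lambda>t. M * (1 - t))"
    using 1 2 le by (intro integral_norm_bound_integral) blast+
  then show ?thesis
    unfolding integral_unique[OF 1] integral_unique[OF 2] by (simp add: M_def)
qed

text \<open>Stirling's upper bound with constant \<open>exp 1\<close>, an equality at
  \<open>k = 1\<close>. The induction step amounts to e \<le> (1 + 1/k)^(k + 1/2).\<close>

lemma fact_le_exp_sqrt_power: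
  assumes "k \<ge> 1"
  shows "fact k \<le> exp 1 * sqrt (real k) * real k ^ k * exp (- real k)"
  using assms
proof (induction k rule: dec_induct)
  case base
  then show ?case by (simp add: exp_minus)
next
  case (step k)
  have k: "real k > 0" using step by simp
  have "2 / (2 * real k + 1) \<le> ln (real (Suc k)) - ln (real k)"
    using ln_inverse_approx_ge[of "real k" "real (Suc k)"] k by (simp add: algebra_simps)
  then have "1 \<le> (real k + 1/2) * (ln (real (Suc k)) - ln (real k))"
    using k by (simp add: field_simps)
  then have "exp 1 \<le> exp ((real k + 1/2) * (ln (real (Suc k)) - ln (real k)))" by simp
  also have "\<dots> = (real (Suc k) powr (real k + 1/2)) / (real k powr (real k + 1/2))"
    using k by (simp add: powr_def exp_diff right_diff_distrib)
  finally have "exp 1 * (real k powr (real k + 1/2)) \<le> real (Suc k) powr (real k + 1/2)"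
    using k by (simp add: field_simps)
  then have h: "exp 1 * (sqrt (real k) * real k ^ k) \<le> sqrt (real (Suc k)) * real (Suc k) ^ k"
    using k by (simp add: powr_add powr_realpow powr_half_sqrt mult.commute)
  have "fact (Suc k) = real (Suc k) * fact k" by simp
  also have "\<dots> \<le> real (Suc k) * (exp 1 * sqrt (real k) * real k ^ k * exp (- real k))"
    using step by (intro mult_left_mono) auto
  also have "\<dots> = real (Suc k) * exp (- real k) * (exp 1 * (sqrt (real k) * real k ^ k))"
    by simp
  also have "\<dots> \<le> real (Suc k) * exp (- real k) * (sqrt (real (Suc k)) * real (Suc k) ^ k)"
    using h by (intro mult_left_mono) auto
  also have "\<dots> = exp 1 * sqrt (real (Suc k)) * real (Suc k) ^ Suc k * exp (- real (Suc k))"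
    by (simp add: exp_diff exp_minus field_simps exp_add)
  finally show ?case .
qed

section \<open>The Gaussian integrals on the circle\<close>

text \<open>Jordan's inequality: the sine is concave on [0, pi/2] and so lies above its
  chord.\<close>

lemma sin_pi_times_ge:
  fixes t :: real
  assumes "0 \<le> t" "t \<le> 1/2"
  shows "2 * t \<le> sin (pi * t)"
proof -
  have "convex_on {0..pi/2} (\<lambda>x::real. - sin x)"
    by (rule f''_ge0_imp_convex[where f'="\<lambda>x. - cos x" and f''="\<lambda>x. sin x"])
       (auto intro!: derivative_eq_intros sin_ge_zero)
  then have "- sin ((1 - 2 * t) *\<^sub>R 0 + (2 * t) *\<^sub>R (pi/2)) \<le> (1 - 2 * t) * (- sin 0) + 2 * t * (- sin (pi/2))"
    using assms by (intro convex_onD) auto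
  then show ?thesis by (simp add: mult.commute)
qed

text \<open>The half-line Gaussian moment after an affine substitution; shrinking the domain to
  [0, 1] only decreases the integral of a nonnegative function. A negative \<open>c\<close> is
  allowed because the reflected half of the circle needs one.\<close>

lemma integral_gaussian_moment_affine_le:
  fixes c d :: real and k :: nat
  assumes "c \<noteq> 0"
  defines "f \<equiv> \<lambda>x::real. indicator {0..} x * (exp (- x\<^sup>2) * x ^ (2 * k))"
  shows "(\<lambda>t. f (d + c * t)) integrable_on {0..1}"
    and "integral {0..1} (\<lambda>t. f (d + c * t)) \<le> sqrt pi / 2 * (fact (2 * k) / (2 ^ (2 * k) * fact k)) / \<bar>c\<bar>"
proof -
  define I where "I = sqrt pi / 2 * (fact (2 * k) / (2 ^ (2 * k) * fact k))"
  have "has_bochner_integral lborel f I"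
    using gaussian_moment_even_pos[of k] by (simp add: f_def I_def)
  then have *: "has_bochner_integral lborel (\<lambda>t. f (d + c * t)) (I /\<^sub>R \<bar>c\<bar>)"
    using lborel_has_bochner_integral_real_affine_iff[of c f I d] assms(1) by simp
  then have hi: "((\<lambda>t. f (d + c * t)) has_integral (I / \<bar>c\<bar>)) UNIV"
    using has_integral_integral_real[of "\<lambda>t. f (d + c * t)"]
    by (simp add: has_bochner_integral_iff divide_inverse_commute)
  show i: "(\<lambda>t. f (d + c * t)) integrable_on {0..1}"
    using hi integrable_on_subinterval[of _ UNIV 0 1] by blast
  have "integral {0..1} (\<lambda>t. f (d + c * t)) \<le> integral UNIV (\<lambda>t. f (d + c * t))"
    using i hi by (intro integral_subset_le) (auto simp: f_def indicator_def)
  then show "integral {0..1} (\<lambda>t. f (d + c * t)) \<le> I / \<bar>c\<bar>"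
    using hi by (simp add: integral_unique)
qed

text \<open>The sine lies between \<open>2 * t\<close> and \<open>pi * t\<close>: the lower bound
  goes into the exponent, where 2 \<rho> (2t)^2 = 8 \<rho> t^2, and the upper bound into the
  power.\<close>

lemma sin_pi_power_exp_le:
  fixes t \<rho> :: real
  assumes "0 \<le> t" "t \<le> 1/2" "\<rho> > 0"
  shows "sin (pi * t) ^ (2 * k) * exp (- 2 * \<rho> * (sin (pi * t))\<^sup>2)
    \<le> (pi\<^sup>2 / (8 * \<rho>)) ^ k * (exp (- (sqrt (8 * \<rho>) * t)\<^sup>2) * (sqrt (8 * \<rho>) * t) ^ (2 * k))"
proof -
  have s: "2 * t \<le> sin (pi * t)" using assms by (intro sin_pi_times_ge) auto
  then have "(2 * t)\<^sup>2 \<le> (sin (pi * t))\<^sup>2" using assms by (intro power_mono) auto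
  then have "exp (- 2 * \<rho> * (sin (pi * t))\<^sup>2) \<le> exp (- (sqrt (8 * \<rho>) * t)\<^sup>2)"
    using assms by (simp add: power_mult_distrib)
  moreover have "sin (pi * t) ^ (2 * k) \<le> (pi * t) ^ (2 * k)"
    using assms s by (intro power_mono sin_x_le_x) auto
  moreover have "(pi * t) ^ (2 * k) = (pi\<^sup>2 / (8 * \<rho>)) ^ k * (sqrt (8 * \<rho>) * t) ^ (2 * k)"
    using assms by (simp add: power_mult power_mult_distrib power_divide)
  ultimately have "sin (pi * t) ^ (2 * k) * exp (- 2 * \<rho> * (sin (pi * t))\<^sup>2)
    \<le> ((pi\<^sup>2 / (8 * \<rho>)) ^ k * (sqrt (8 * \<rho>) * t) ^ (2 * k)) * exp (- (sqrt (8 * \<rho>) * t)\<^sup>2)"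
    using assms by (intro mult_mono) auto
  then show ?thesis by (simp add: mult_ac)
qed

lemma integral_sin_pi_power_exp_le:
  fixes \<rho> :: real
  assumes "\<rho> > 0"
  shows "integral {0..1} (\<lambda>t. sin (pi * t) ^ (2 * k) * exp (- 2 * \<rho> * (sin (pi * t))\<^sup>2))
    \<le> (pi\<^sup>2 / (8 * \<rho>)) ^ k * (sqrt pi * (fact (2 * k) / (2 ^ (2 * k) * fact k)) / sqrt (8 * \<rho>))"
proof -
  define f :: "real \<Rightarrow> real" where "f = (\<lambda>x. indicator {0..} x * (exp (- x\<^sup>2) * x ^ (2 * k)))"
  define g where "g = (\<lambda>t. sin (pi * t) ^ (2 * k) * exp (- 2 * \<rho> * (sin (pi * t))\<^sup>2))"
  define c where "c = sqrt (8 * \<rho>)"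
  define K where "K = (pi\<^sup>2 / (8 * \<rho>)) ^ k"
  define J where "J = sqrt pi / 2 * (fact (2 * k) / (2 ^ (2 * k) * fact k)) / c"
  have c: "c > 0" using assms by (simp add: c_def)
  have K: "K \<ge> 0" using assms by (simp add: K_def)
  have f0: "f x \<ge> 0" for x by (simp add: f_def indicator_def)
  have half: "g t \<le> K * f (c * t)" if "0 \<le> t" "t \<le> 1/2" for t
    using sin_pi_power_exp_le[OF that assms, of k] that c
    by (simp add: g_def K_def f_def c_def indicator_def)
  \<comment> \<open>The linear bound on the sine holds only up to \<open>1/2\<close>; the other half of the circle is its reflection.\<close>
  have refl: "g (1 - t) = g t" for t
    by (simp add: g_def right_diff_distrib sin_diff)
  \<comment> \<open>On each half one summand dominates \<open>g\<close> and the other is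
    nonnegative, so the integral need not be split at 1/2.\<close>
  have le: "g t \<le> K * (f (0 + c * t) + f (c + (- c) * t))" if t: "t \<in> {0..1}" for t
  proof (cases "t \<le> 1/2")
    case True
    then show ?thesis using half[of t] t mult_nonneg_nonneg[OF K f0, of "c - c * t"]
      by (simp add: algebra_simps)
  next
    case False
    then show ?thesis using half[of "1 - t"] t mult_nonneg_nonneg[OF K f0, of "c * t"]
      by (simp add: algebra_simps refl)
  qed
  have i1: "(\<lambda>t. f (0 + c * t)) integrable_on {0..1}" "integral {0..1} (\<lambda>t. f (0 + c * t)) \<le> J"
    using integral_gaussian_moment_affine_le[of c 0 k] c by (simp_all add: f_def J_def)
  have i2: "(\<lambda>t. f (c + (- c) * t)) integrable_on {0..1}" "integral {0..1} (\<lambda>t. f (c + (- c) * t)) \<le> J"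
    using integral_gaussian_moment_affine_le[of "- c" c k] c by (simp_all add: f_def J_def)
  have "integral {0..1} g \<le> integral {0..1} (\<lambda>t. K * (f (0 + c * t) + f (c + (- c) * t)))"
  proof (rule integral_le)
    show "g integrable_on {0..1}"
      unfolding g_def by (intro integrable_continuous_real continuous_intros)
    show "(\<lambda>t. K * (f (0 + c * t) + f (c + (- c) * t))) integrable_on {0..1}"
      using integrable_add[OF i1(1) i2(1)] integrable_on_mult_right by blast
  qed (use le in auto)
  also have "\<dots> = K * (integral {0..1} (\<lambda>t. f (0 + c * t)) + integral {0..1} (\<lambda>t. f (c + (- c) * t)))"
    using integral_add[OF i1(1) i2(1)] by simp
  also have "\<dots> \<le> K * (J + J)"
    using i1(2) i2(2) K by (intro mult_left_mono add_mono) auto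
  also have "\<dots> = (pi\<^sup>2 / (8 * \<rho>)) ^ k * (sqrt pi * (fact (2 * k) / (2 ^ (2 * k) * fact k)) / sqrt (8 * \<rho>))"
    by (simp add: K_def J_def c_def field_simps)
  finally show ?thesis unfolding g_def .
qed

text \<open>The zeroth moment; its constant \<open>sqrt (pi / 8)\<close> is below 1.\<close>

lemma integral_exp_sin_le:
  fixes \<rho> :: real
  assumes "\<rho> > 0"
  shows "integral {0..1} (\<lambda>t. exp (- 2 * \<rho> * (sin (pi * t))\<^sup>2)) \<le> \<rho> powr (- (1/2))"
proof -
  have "integral {0..1} (\<lambda>t. exp (- 2 * \<rho> * (sin (pi * t))\<^sup>2)) \<le> sqrt pi / sqrt (8 * \<rho>)"
    using integral_sin_pi_power_exp_le[OF assms, of 0] by simp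
  also have "\<dots> = sqrt (pi / (8 * \<rho>))" by (simp only: real_sqrt_divide)
  also have "\<dots> \<le> sqrt (1 / \<rho>)"
    using assms pi_less_4 by (intro real_sqrt_le_mono) (simp add: field_simps)
  also have "\<dots> = 1 / sqrt \<rho>" by (simp add: real_sqrt_divide)
  also have "\<dots> = \<rho> powr (- (1/2))"
    using assms by (simp add: powr_minus powr_half_sqrt field_simps)
  finally show ?thesis .
qed

text \<open>The second moment. Its constant is about 0.39; it is rounded up to 1/2, the value of the
  integral without the exponential, so that both bounds combine into 1/2 times a minimum.\<close>

lemma integral_sin_exp_sin_le:
  fixes \<rho> :: real
  assumes "\<rho> > 0"
  shows "integral {0..1} (\<lambda>t. (sin (pi * t))\<^sup>2 * exp (- 2 * \<rho> * (sin (pi * t))\<^sup>2)) \<le> 1/2 * \<rho> powr (- (3/2))"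
proof -
  have "integral {0..1} (\<lambda>t. (sin (pi * t))\<^sup>2 * exp (- 2 * \<rho> * (sin (pi * t))\<^sup>2))
      \<le> pi\<^sup>2 / (8 * \<rho>) * (sqrt pi / 2 / sqrt (8 * \<rho>))"
    using integral_sin_pi_power_exp_le[OF assms, of 1] by (simp add: fact_2 numeral_2_eq_2[symmetric])
  also have "\<dots> = (pi\<^sup>2 / 16) * (sqrt pi / sqrt 8) * \<rho> powr (- (3/2))"
  proof -
    have "\<rho> powr (- (3/2)) = 1 / (\<rho> * sqrt \<rho>)"
      using assms powr_add[of \<rho> 1 "1/2"] by (simp add: powr_minus powr_half_sqrt field_simps)
    then show ?thesis by (simp add: real_sqrt_mult)
  qed
  also have "\<dots> \<le> 1/2 * \<rho> powr (- (3/2))"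
  proof (rule mult_right_mono)
    have pi: "pi \<le> 3.15" using pi_approx by simp
    have "pi\<^sup>2 \<le> 3.15\<^sup>2" using pi by (intro power_mono) auto
    then have 1: "pi\<^sup>2 / 16 \<le> 0.63" by (simp add: power2_eq_square)
    have "sqrt pi / sqrt 8 = sqrt (pi / 8)" by (simp add: real_sqrt_divide)
    also have "\<dots> \<le> sqrt ((0.64)\<^sup>2)" using pi by (intro real_sqrt_le_mono) (simp add: power2_eq_square)
    finally have 2: "sqrt pi / sqrt 8 \<le> 0.64" by simp
    have "(pi\<^sup>2 / 16) * (sqrt pi / sqrt 8) \<le> 0.63 * 0.64" using 1 2 by (intro mult_mono) auto
    also have "\<dots> \<le> (1/2 :: real)" by simp
    finally show "(pi\<^sup>2 / 16) * (sqrt pi / sqrt 8) \<le> 1/2" .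
  qed auto
  finally show ?thesis .
qed

lemma has_integral_sin_pi_squared: "((\<lambda>t::real. (sin (pi * t))\<^sup>2) has_integral 1/2) {0..1}"
proof -
  have "((\<lambda>t::real. (sin (pi * t))\<^sup>2) has_integral
      (1/2 - sin (2 * (pi * 1)) / (4 * pi)) - (0/2 - sin (2 * (pi * 0)) / (4 * pi))) {0..1}"
  proof (rule fundamental_theorem_of_calculus)
    fix t :: real
    have "((\<lambda>t. t/2 - sin (2 * (pi * t)) / (4 * pi)) has_real_derivative (1/2 - cos (2 * (pi * t)) / 2))
        (at t within {0..1})"
      by (auto intro!: derivative_eq_intros simp: field_simps)
    then show "((\<lambda>t. t/2 - sin (2 * (pi * t)) / (4 * pi)) has_vector_derivative (sin (pi * t))\<^sup>2) (at t within {0..1})"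
      unfolding has_real_derivative_iff_has_vector_derivative[symmetric]
      by (simp add: cos_double_sin diff_divide_distrib)
  qed auto
  then show ?thesis by simp
qed

lemma integral_sin_exp_sin_le_half:
  fixes \<rho> :: real
  assumes "\<rho> \<ge> 0"
  shows "integral {0..1} (\<lambda>t. (sin (pi * t))\<^sup>2 * exp (- 2 * \<rho> * (sin (pi * t))\<^sup>2)) \<le> 1/2"
proof -
  have "integral {0..1} (\<lambda>t. (sin (pi * t))\<^sup>2 * exp (- 2 * \<rho> * (sin (pi * t))\<^sup>2))
      \<le> integral {0..1} (\<lambda>t. (sin (pi * t))\<^sup>2)"
    using assms by (intro integral_le integrable_continuous_real continuous_intros) (auto intro!: mult_left_le)
  then show ?thesis using integral_unique[OF has_integral_sin_pi_squared] by simp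
qed

text \<open>At \<rho> = 0 only the trivial bound 1 is available, in agreement with the convention in
  \<open>min_one_neg_powr\<close>.\<close>

lemma integral_exp_sin_le_min:
  assumes "\<rho> \<ge> 0"
  shows "integral {0..1} (\<lambda>t. exp (- 2 * \<rho> * (sin (pi * t))\<^sup>2)) \<le> min_one_neg_powr \<rho> (1/2)"
proof -
  have "integral {0..1} (\<lambda>t. exp (- 2 * \<rho> * (sin (pi * t))\<^sup>2)) \<le> integral {0..1} (\<lambda>t::real. 1)"
    using assms by (intro integral_le integrable_continuous_real continuous_intros) auto
  then show ?thesis
    using integral_exp_sin_le[of \<rho>] assms by (auto simp: min_one_neg_powr_def)
qed

lemma integral_sin_exp_sin_le_min:
  assumes "\<rho> \<ge> 0"
  shows "integral {0..1} (\<lambda>t. (sin (pi * t))\<^sup>2 * exp (- 2 * \<rho> * (sin (pi * t))\<^sup>2)) \<le> 1/2 * min_one_neg_powr \<rho> (3/2)"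
  using integral_sin_exp_sin_le[of \<rho>] integral_sin_exp_sin_le_half[of \<rho>] assms
  by (auto simp: min_one_neg_powr_def min_def)

section \<open>Cauchy estimates for the generating function\<close>

text \<open>Cauchy's formula on the circle of radius \<open>r\<close>: the denominator of degree
  \<open>k + 1\<close> against the speed \<open>2 * pi * r\<close> leaves
  \<open>2 * pi / r ^ k\<close>. The majorant \<open>g\<close> may depend on the angle, which keeps
  the decay away from \<open>t = 0\<close>.\<close>

lemma taylor_coeff_norm_le_circle_mean:
  fixes f :: "complex \<Rightarrow> complex" and g :: "real \<Rightarrow> real"
  assumes "r > 0" "f holomorphic_on UNIV"
    and g: "g integrable_on {0..1}"
    and le: "\<And>t. t \<in> {0..1} \<Longrightarrow> norm (f (of_real r * exp (2 * of_real pi * \<i> * of_real t))) \<le> g t"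
  shows "norm ((deriv ^^ k) f 0 / fact k) \<le> integral {0..1} g / r ^ k"
proof -
  define c where "c = (deriv ^^ k) f 0 / fact k"
  define h where "h = (\<lambda>t. f (of_real r * exp (2 * of_real pi * \<i> * of_real t))
      / (of_real r * exp (2 * of_real pi * \<i> * of_real t)) ^ Suc k
      * (2 * pi * \<i> * r * exp (2 * of_real pi * \<i> * of_real t)))"
  have "((\<lambda>u. f u / (u - 0) ^ Suc k) has_contour_integral (2 * pi * \<i>) / fact k * (deriv ^^ k) f 0) (circlepath 0 r)"
    using assms(1,2) holomorphic_on_subset[OF assms(2)] holomorphic_on_imp_continuous_on
    by (intro Cauchy_has_contour_integral_higher_derivative_circlepath) (auto intro: holomorphic_on_imp_continuous_on)
  then have h: "(h has_integral (2 * pi * \<i> * c)) {0..1}"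
    unfolding has_contour_integral vector_derivative_circlepath
    unfolding circlepath h_def c_def by (simp only: diff_zero add_0_left times_divide_eq_left times_divide_eq_right)
  have "norm (integral {0..1} h) \<le> integral {0..1} (\<lambda>t. 2 * pi / r ^ k * g t)"
  proof (rule integral_norm_bound_integral)
    show "h integrable_on {0..1}" using h by blast
    show "(\<lambda>t. 2 * pi / r ^ k * g t) integrable_on {0..1}" by (rule integrable_on_mult_right[OF g])
    fix t :: real assume t: "t \<in> {0..1}"
    have "norm (h t) = 2 * pi / r ^ k * norm (f (of_real r * exp (2 * of_real pi * \<i> * of_real t)))"
      using assms(1) by (simp add: h_def norm_mult norm_divide norm_power field_simps)
    also have "\<dots> \<le> 2 * pi / r ^ k * g t"
      using assms(1) le[OF t] by (intro mult_left_mono) auto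
    finally show "norm (h t) \<le> 2 * pi / r ^ k * g t" .
  qed
  then have "2 * pi * norm c \<le> 2 * pi * (integral {0..1} g / r ^ k)"
    unfolding integral_unique[OF h] by (simp add: norm_mult)
  then have "norm c \<le> integral {0..1} g / r ^ k"
    by (rule mult_left_le_imp_le) simp
  then show ?thesis by (simp add: c_def)
qed

text \<open>Dividing every factor by its weight reduces the claim to the telescoping bound for
  factors of modulus at most 1. The product of all weights is retained, and with it the full
  exponential decay.\<close>

lemma norm_prod_diff_le_weighted:
  fixes a b :: "'i \<Rightarrow> complex" and m :: "'i \<Rightarrow> real"
  assumes "finite I" and m: "\<And>i. i \<in> I \<Longrightarrow> m i > 0"
    and "\<And>i. i \<in> I \<Longrightarrow> norm (a i) \<le> m i" "\<And>i. i \<in> I \<Longrightarrow> norm (b i) \<le> m i"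
  shows "norm ((\<Prod>i\<in>I. a i) - (\<Prod>i\<in>I. b i)) \<le> (\<Prod>i\<in>I. m i) * (\<Sum>i\<in>I. norm (a i - b i) / m i)"
proof -
  have e: "(\<Prod>i\<in>I. f i) = of_real (\<Prod>i\<in>I. m i) * (\<Prod>i\<in>I. f i / of_real (m i))" for f :: "'i \<Rightarrow> complex"
    using m by (simp add: prod.distrib[symmetric]) (intro prod.cong, auto dest: m)
  have mp: "(\<Prod>i\<in>I. m i) > 0" using m by (intro prod_pos) auto
  have "norm ((\<Prod>i\<in>I. a i) - (\<Prod>i\<in>I. b i))
     = (\<Prod>i\<in>I. m i) * norm ((\<Prod>i\<in>I. a i / of_real (m i)) - (\<Prod>i\<in>I. b i / of_real (m i)))"
    unfolding e[of a] e[of b] right_diff_distrib[symmetric] norm_mult using mp by (simp add: norm_of_real del: of_real_prod)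
  also have "\<dots> \<le> (\<Prod>i\<in>I. m i) * (\<Sum>i\<in>I. norm (a i / of_real (m i) - b i / of_real (m i)))"
    using assms mp by (intro mult_left_mono norm_prod_diff) (auto simp: norm_divide less_imp_le)
  also have "\<dots> = (\<Prod>i\<in>I. m i) * (\<Sum>i\<in>I. norm (a i - b i) / m i)"
    using m by (simp add: diff_divide_distrib[symmetric] norm_divide less_imp_le)
  finally show ?thesis .
qed

lemma Re_circle_point: "Re (of_real r * exp (2 * of_real pi * \<i> * of_real t)) = r * (1 - 2 * (sin (pi * t))\<^sup>2)"
  for r t :: real
proof -
  have "Re (exp (2 * of_real pi * \<i> * of_real t)) = cos (2 * (pi * t))"
    by (simp add: Re_exp mult_ac)
  then show ?thesis by (simp add: cos_double_sin)
qed

text \<open>On the circle the squared modulus is affine in \<open>s\<close>, which will be sin^2(pi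
  t). It serves for the Bernoulli factor (\<open>x = 1 - p\<close>, \<open>y = p\<close>) and for
  \<open>w - 1\<close> (\<open>x = -1\<close>, \<open>y = 1\<close>).\<close>

lemma norm_squared_affine_on_circle:
  fixes w :: complex
  assumes "norm w = r" "Re w = r * (1 - 2 * s)"
  shows "(norm (of_real x + of_real y * w))\<^sup>2 = (x + y * r)\<^sup>2 - 4 * x * y * r * s"
proof -
  have im: "(Im w)\<^sup>2 = r\<^sup>2 - (Re w)\<^sup>2" using assms(1) cmod_power2[of w] by simp
  have "(norm (of_real x + of_real y * w))\<^sup>2 = (x + y * Re w)\<^sup>2 + y\<^sup>2 * (Im w)\<^sup>2"
    by (simp add: cmod_power2 power_mult_distrib)
  also have "\<dots> = (x + y * r)\<^sup>2 - 4 * x * y * r * s"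
    unfolding im assms(2) by (simp add: power2_eq_square algebra_simps)
  finally show ?thesis .
qed

text \<open>One weight \<open>m\<close> has to dominate both kinds of factor. The decay rate
  \<open>p * (1 - p)\<close> is dictated by the Bernoulli factor, which does not decay at all for
  \<open>p = 1\<close>; the difference of the factors is the second-order remainder of the
  exponential.\<close>

lemma bernoulli_factor_bounds:
  fixes p r s :: real and w :: complex
  assumes p: "0 \<le> p" "p \<le> 1" and r: "r > 0" and s: "0 \<le> s" "s \<le> 1"
    and w: "norm w = r" "Re w = r * (1 - 2 * s)"
  defines "m \<equiv> exp (p * (r - 1) - 2 * p * (1 - p) * min r (1 / r) * s)"
  shows norm_bernoulli_factor_le: "norm (1 + of_real p * (w - 1)) \<le> m"
    and norm_exp_factor_le: "norm (exp (of_real p * (w - 1))) \<le> m"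
    and norm_factor_diff_le: "norm (1 + of_real p * (w - 1) - exp (of_real p * (w - 1))) / m
      \<le> p\<^sup>2 * (exp (1/2) / 2 * exp (max 0 (1 - r)) * ((r - 1)\<^sup>2 + 4 * r * s))"
proof -
  define \<mu> where "\<mu> = min r (1 / r)"
  have mu: "0 \<le> \<mu>" "\<mu> \<le> r" "\<mu> \<le> 1"
    using r by (cases "r \<ge> 1"; simp add: \<mu>_def min_le_iff_disj)+
  define A where "A = (1 - p) + p * r"
  have A: "0 \<le> A" using p r by (simp add: A_def)
  \<comment> \<open>\<open>A\<close> is a convex combination of 1 and \<open>r\<close>, so
    \<open>A \<le> max 1 r\<close>, and (max 1 r)^2 * min r (1/r) = r.\<close>
  have "A\<^sup>2 * \<mu> \<le> r"
  proof (cases "r \<ge> 1")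
    case True
    have "p * (r - 1) \<le> 1 * (r - 1)" using True p by (intro mult_right_mono) auto
    then have "A \<le> r" by (simp add: A_def algebra_simps)
    then have "A\<^sup>2 \<le> r\<^sup>2" using A by (intro power_mono)
    then have "A\<^sup>2 * (1 / r) \<le> r" using r by (simp add: field_simps power2_eq_square)
    moreover have "A\<^sup>2 * \<mu> \<le> A\<^sup>2 * (1 / r)" by (intro mult_left_mono) (auto simp: \<mu>_def)
    ultimately show ?thesis by linarith
  next
    case False
    have "p * (r - 1) \<le> 0" using False p by (simp add: mult_nonneg_nonpos)
    then have "A \<le> 1" by (simp add: A_def algebra_simps)
    then have "A\<^sup>2 * \<mu> \<le> 1 * r" using A mu by (intro mult_mono power_le_one) auto
    then show ?thesis by simp
  qed
  then have "4 * p * (1 - p) * s * (A\<^sup>2 * \<mu>) \<le> 4 * p * (1 - p) * s * r"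
    using p s by (intro mult_left_mono) auto
  moreover have "1 + of_real p * (w - 1) = of_real (1 - p) + of_real p * w" by (simp add: algebra_simps)
  ultimately have "(norm (1 + of_real p * (w - 1)))\<^sup>2 \<le> A\<^sup>2 * (1 + - (4 * p * (1 - p) * \<mu> * s))"
    unfolding A_def using norm_squared_affine_on_circle[OF w, of "1 - p" p] by (simp add: algebra_simps)
  also have "\<dots> \<le> A\<^sup>2 * exp (- (4 * p * (1 - p) * \<mu> * s))"
    by (intro mult_left_mono exp_ge_add_one_self) auto
  also have "\<dots> \<le> (exp (p * (r - 1)))\<^sup>2 * exp (- (4 * p * (1 - p) * \<mu> * s))"
    using A exp_ge_add_one_self[of "p * (r - 1)"]
    by (intro mult_right_mono power_mono) (auto simp: A_def algebra_simps)
  also have "\<dots> = m\<^sup>2"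
    by (simp add: m_def \<mu>_def exp_double[symmetric] exp_add[symmetric] algebra_simps)
  finally show "norm (1 + of_real p * (w - 1)) \<le> m"
    by (rule power2_le_imp_le) (simp add: m_def)
  \<comment> \<open>The exponential factor has modulus exactly
    \<open>exp (p * (r - 1) - 2 * p * r * s)\<close>, so its decay is at least as fast as that of
    \<open>m\<close>.\<close>
  have "2 * p * (1 - p) * \<mu> * s \<le> 2 * p * r * s"
  proof -
    have "(1 - p) * \<mu> \<le> 1 * r" using p mu by (intro mult_mono) auto
    then have "(2 * p * s) * ((1 - p) * \<mu>) \<le> (2 * p * s) * (1 * r)" using p s by (intro mult_left_mono) auto
    then show ?thesis by (simp only: mult_ac mult_1_left)
  qed
  moreover have Re: "Re (of_real p * (w - 1)) = p * (r - 1) - 2 * p * r * s"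
    by (simp add: w(2) algebra_simps)
  ultimately show "norm (exp (of_real p * (w - 1))) \<le> m"
    unfolding norm_exp_eq_Re m_def \<mu>_def[symmetric] exp_le_cancel_iff by linarith
  have "Re (of_real p * (w - 1)) \<le> p * (r - 1)"
    unfolding Re using p s r by simp
  then have "norm (exp (of_real p * (w - 1)) - 1 - of_real p * (w - 1))
      \<le> (norm (of_real p * (w - 1)))\<^sup>2 / 2 * max 1 (exp (p * (r - 1)))"
    by (intro order_trans[OF norm_exp_minus_one_minus_le] mult_left_mono max.mono) auto
  also have "(norm (of_real p * (w - 1)))\<^sup>2 = p\<^sup>2 * ((r - 1)\<^sup>2 + 4 * r * s)"
    unfolding norm_mult power_mult_distrib
    using norm_squared_affine_on_circle[OF w, of "-1" 1] by (simp add: power2_commute mult_ac)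
  finally have *: "norm (1 + of_real p * (w - 1) - exp (of_real p * (w - 1)))
      \<le> p\<^sup>2 * ((r - 1)\<^sup>2 + 4 * r * s) / 2 * max 1 (exp (p * (r - 1)))"
    by (simp add: norm_minus_commute algebra_simps)
  \<comment> \<open>The factor \<open>exp (1/2)\<close> pays for dividing by \<open>m\<close>, since \<open>2 p (1 - p) \<le> 1/2\<close>.\<close>
  have "max 1 (exp (p * (r - 1))) \<le> exp (1/2) * exp (max 0 (1 - r)) * m"
  proof -
    have "2 * (p * (1 - p)) \<le> 1/2"
      using zero_le_power2[of "2 * p - 1"] by (simp add: power2_eq_square algebra_simps)
    moreover have "\<mu> * s \<le> 1 * 1" using mu s by (intro mult_mono) auto
    ultimately have "(2 * (p * (1 - p))) * (\<mu> * s) \<le> 1/2 * 1"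
      using p mu s by (intro mult_mono) auto
    then have 1: "0 \<le> 1/2 - 2 * p * (1 - p) * \<mu> * s" by (simp add: mult_ac)
    have 2: "p * (r - 1) \<le> max 0 (1 - r) + p * (r - 1)" by simp
    \<comment> \<open>For \<open>r < 1\<close> the term \<open>p * (r - 1)\<close> is negative, but
      \<open>p \<le> 1\<close> lets \<open>1 - r\<close> compensate it.\<close>
    have 3: "0 \<le> max 0 (1 - r) + p * (r - 1)"
    proof (cases "r \<ge> 1")
      case True then show ?thesis using p by simp
    next
      case False
      then have "p * (1 - r) \<le> 1 * (1 - r)" using p by (intro mult_right_mono) auto
      then show ?thesis using False by (simp add: algebra_simps)
    qed
    have "exp (1/2) * exp (max 0 (1 - r)) * m
        = exp ((1/2 - 2 * p * (1 - p) * \<mu> * s) + (max 0 (1 - r) + p * (r - 1)))"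
      by (simp add: m_def \<mu>_def exp_add[symmetric] algebra_simps)
    moreover have "max 1 (exp (p * (r - 1))) \<le> exp ((1/2 - 2 * p * (1 - p) * \<mu> * s) + (max 0 (1 - r) + p * (r - 1)))"
      using 1 2 3 by (intro max.boundedI) auto
    ultimately show ?thesis by simp
  qed
  then have "p\<^sup>2 * ((r - 1)\<^sup>2 + 4 * r * s) / 2 * max 1 (exp (p * (r - 1)))
    \<le> p\<^sup>2 * ((r - 1)\<^sup>2 + 4 * r * s) / 2 * (exp (1/2) * exp (max 0 (1 - r)) * m)"
    using r s by (intro mult_left_mono) auto
  with * have "norm (1 + of_real p * (w - 1) - exp (of_real p * (w - 1)))
      \<le> p\<^sup>2 * (exp (1/2) / 2 * exp (max 0 (1 - r)) * ((r - 1)\<^sup>2 + 4 * r * s)) * m"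
    by (simp add: mult_ac)
  then show "norm (1 + of_real p * (w - 1) - exp (of_real p * (w - 1))) / m
      \<le> p\<^sup>2 * (exp (1/2) / 2 * exp (max 0 (1 - r)) * ((r - 1)\<^sup>2 + 4 * r * s))"
    by (subst pos_divide_le_eq) (auto simp: m_def)
qed

text \<open>For \<open>P\<close> the generating polynomial of W, \<open>G\<close> is the difference
  of the two generating functions. Its Taylor coefficients are read off from formal power
  series.\<close>

lemma poly_minus_exp_coeff:
  fixes P :: "real poly" and L :: real
  defines "G \<equiv> \<lambda>w :: complex. poly (map_poly of_real P) w - exp (of_real L * (w - 1))"
  shows "G holomorphic_on UNIV"
    and "(deriv ^^ k) G 0 / fact k = of_real (coeff P k - L ^ k / fact k * exp (- L))"
proof -
  define Q :: "complex poly" where "Q = map_poly of_real P"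
  have G: "G = (\<lambda>w. poly Q w - exp (- of_real L) * exp (of_real L * w))"
    by (simp add: G_def Q_def fun_eq_iff exp_add[symmetric] algebra_simps)
  show "G holomorphic_on UNIV" unfolding G by (intro holomorphic_intros)
  have "poly Q has_fps_expansion fps_of_poly Q"
    by (simp add: has_fps_expansion_def)
  then have "G has_fps_expansion fps_of_poly Q - fps_const (exp (- of_real L)) * fps_exp (of_real L)"
    unfolding G by (intro fps_expansion_intros) auto
  then have "(deriv ^^ k) G 0 / fact k = fps_nth (fps_of_poly Q - fps_const (exp (- of_real L)) * fps_exp (of_real L)) k"
    by (rule fps_nth_fps_expansion[symmetric])
  also have "\<dots> = of_real (coeff P k - L ^ k / fact k * exp (- L))"
    by (simp add: Q_def coeff_map_poly exp_of_real[symmetric])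
  finally show "(deriv ^^ k) G 0 / fact k = of_real (coeff P k - L ^ k / fact k * exp (- L))" .
qed

lemma map_poly_of_real_mult:
  "map_poly complex_of_real (p * q) = map_poly of_real p * map_poly of_real q"
  by (rule poly_eqI) (simp add: coeff_map_poly coeff_mult)

text \<open>The Cauchy estimate with the radius left free and the two angular integrals unevaluated,
  so that it serves both \<open>r = 1\<close> and \<open>r = k / L\<close>.\<close>

lemma poisson_binomial_coeff_bound:
  fixes p :: "'i \<Rightarrow> real"
  assumes "finite I" and p: "\<And>i. i \<in> I \<Longrightarrow> 0 \<le> p i \<and> p i \<le> 1" and r: "r > 0"
  defines "L \<equiv> (\<Sum>i\<in>I. p i)" and "L2 \<equiv> (\<Sum>i\<in>I. (p i)\<^sup>2)"
  defines "\<rho> \<equiv> (L - L2) * min r (1 / r)"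
  shows "\<bar>coeff (\<Prod>i\<in>I. [:1 - p i, p i:]) k - L ^ k / fact k * exp (- L)\<bar>
    \<le> exp (L * (r - 1)) / r ^ k * L2 * (exp (1/2) / 2 * exp (max 0 (1 - r))) *
      ((r - 1)\<^sup>2 * integral {0..1} (\<lambda>t. exp (- 2 * \<rho> * (sin (pi * t))\<^sup>2)) +
       4 * r * integral {0..1} (\<lambda>t. (sin (pi * t))\<^sup>2 * exp (- 2 * \<rho> * (sin (pi * t))\<^sup>2)))"
proof -
  define P where "P = (\<Prod>i\<in>I. [:1 - p i, p i:])"
  define G where "G = (\<lambda>w :: complex. poly (map_poly of_real P) w - exp (of_real L * (w - 1)))"
  define C where "C = exp (1/2) / 2 * exp (max 0 (1 - r))"
  define E where "E = (\<lambda>t. exp (- 2 * \<rho> * (sin (pi * t))\<^sup>2))"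
  define g where "g = (\<lambda>t. exp (L * (r - 1)) * L2 * C * ((r - 1)\<^sup>2 * E t + 4 * r * ((sin (pi * t))\<^sup>2 * E t)))"
  have P: "poly (map_poly of_real P) w = (\<Prod>i\<in>I. 1 + of_real (p i) * (w - 1))" for w :: complex
  proof -
    have "map_poly complex_of_real P = (\<Prod>i\<in>I. [:1 - of_real (p i), of_real (p i):])"
      unfolding P_def by (induction I rule: infinite_finite_induct)
        (simp_all add: map_poly_of_real_mult map_poly_pCons del: mult_pCons_left)
    then show ?thesis by (simp add: poly_prod algebra_simps)
  qed
  have le: "norm (G (of_real r * exp (2 * of_real pi * \<i> * of_real t))) \<le> g t" for t
  proof -
    define w where "w = of_real r * exp (2 * of_real pi * \<i> * of_real t)"
    define s where "s = (sin (pi * t))\<^sup>2"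
    define m where "m = (\<lambda>i. exp (p i * (r - 1) - 2 * p i * (1 - p i) * min r (1 / r) * s))"
    have w: "norm w = r" "Re w = r * (1 - 2 * s)"
      using r Re_circle_point[of r t] by (simp_all add: w_def s_def norm_mult)
    have s: "0 \<le> s" "s \<le> 1" by (simp_all add: s_def abs_square_le_1)
    \<comment> \<open>The Poisson generating function is split over the same index set, so that
      factors are compared index by index.\<close>
    have "G w = (\<Prod>i\<in>I. 1 + of_real (p i) * (w - 1)) - (\<Prod>i\<in>I. exp (of_real (p i) * (w - 1)))"
      using assms(1) by (simp add: G_def P L_def exp_sum sum_distrib_right)
    also have "norm \<dots> \<le> (\<Prod>i\<in>I. m i) *
        (\<Sum>i\<in>I. norm (1 + of_real (p i) * (w - 1) - exp (of_real (p i) * (w - 1))) / m i)"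
      using assms(1) p norm_bernoulli_factor_le[OF _ _ r s w] norm_exp_factor_le[OF _ _ r s w]
      by (intro norm_prod_diff_le_weighted) (auto simp: m_def)
    also have "\<dots> \<le> (\<Prod>i\<in>I. m i) * (\<Sum>i\<in>I. (p i)\<^sup>2 * (C * ((r - 1)\<^sup>2 + 4 * r * s)))"
      using p norm_factor_diff_le[OF _ _ r s w]
      by (intro mult_left_mono sum_mono prod_nonneg) (auto simp: m_def C_def)
    also have "(\<Prod>i\<in>I. m i) = exp (L * (r - 1)) * E t"
    proof -
      \<comment> \<open>The decay rates \<open>p i * (1 - p i)\<close> add up to
        \<open>L - L2\<close>, the variance of W; this is how \<rho> arises.\<close>
      have "(\<Sum>i\<in>I. p i * (r - 1) - 2 * p i * (1 - p i) * min r (1 / r) * s) = L * (r - 1) - 2 * \<rho> * s"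
        by (simp add: \<rho>_def L_def L2_def sum_subtractf sum_distrib_left sum_distrib_right power2_eq_square
            left_diff_distrib right_diff_distrib mult_ac)
      then show ?thesis
        using assms(1) by (simp add: m_def E_def s_def exp_sum[symmetric] exp_add[symmetric])
    qed
    also have "exp (L * (r - 1)) * E t * (\<Sum>i\<in>I. (p i)\<^sup>2 * (C * ((r - 1)\<^sup>2 + 4 * r * s))) = g t"
      unfolding sum_distrib_right[symmetric] L2_def[symmetric] g_def s_def by (simp add: algebra_simps)
    finally show ?thesis by (simp add: w_def)
  qed
  have i: "E integrable_on {0..1}" "(\<lambda>t. (sin (pi * t))\<^sup>2 * E t) integrable_on {0..1}"
    unfolding E_def by (intro integrable_continuous_real continuous_intros)+
  then have "g integrable_on {0..1}"
    unfolding g_def by (intro integrable_on_mult_right integrable_add)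
  then have "norm ((deriv ^^ k) G 0 / fact k) \<le> integral {0..1} g / r ^ k"
    using r le poly_minus_exp_coeff(1)[of P L] unfolding G_def[symmetric]
    by (intro taylor_coeff_norm_le_circle_mean) auto
  moreover have "norm ((deriv ^^ k) G 0 / fact k) = \<bar>coeff P k - L ^ k / fact k * exp (- L)\<bar>"
    unfolding G_def poly_minus_exp_coeff(2) norm_of_real ..
  moreover have "integral {0..1} g = exp (L * (r - 1)) * L2 * C * ((r - 1)\<^sup>2 * integral {0..1} E
      + 4 * r * integral {0..1} (\<lambda>t. (sin (pi * t))\<^sup>2 * E t))"
    unfolding g_def using i by (simp add: integral_add integrable_on_mult_right)
  ultimately show ?thesis by (simp add: P_def C_def E_def)
qed

section \<open>Sums of independent Bernoulli variables\<close>

text \<open>By induction on \<open>I\<close>: adding one independent Bernoulli variable convolves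
  the law with it, that is, multiplies the generating polynomial by a linear factor.\<close>

lemma (in prob_space) prob_sum_bernoulli:
  fixes X :: "'i \<Rightarrow> 'a \<Rightarrow> nat"
  assumes "finite I" "indep_vars (\<lambda>_. count_space UNIV) X I"
    and "\<And>i. i \<in> I \<Longrightarrow> prob {\<omega> \<in> space M. X i \<omega> = 1} = p i"
    and "\<And>i. i \<in> I \<Longrightarrow> prob {\<omega> \<in> space M. X i \<omega> = 0} = 1 - p i"
  shows "prob {\<omega> \<in> space M. (\<Sum>i\<in>I. X i \<omega>) = k} = coeff (\<Prod>i\<in>I. [:1 - p i, p i:]) k"
  using assms
proof (induction I arbitrary: k rule: finite_induct)
  case empty
  then show ?case by (auto simp: prob_space coeff_eq_0)
next
  case (insert i I)
  define S where "S = (\<lambda>\<omega>. \<Sum>i\<in>I. X i \<omega>)"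
  define A where "A = (\<lambda>a. {\<omega> \<in> space M. X i \<omega> = a})"
  define B where "B = (\<lambda>b. {\<omega> \<in> space M. S \<omega> = b})"
  have "indep_vars (\<lambda>_. count_space UNIV) X I"
    using insert.prems(1) by (rule indep_vars_subset) auto
  then have IH: "prob (B b) = coeff (\<Prod>i\<in>I. [:1 - p i, p i:]) b" for b
    unfolding B_def S_def using insert by (intro insert.IH) auto
  \<comment> \<open>Real values are taken so that \<open>indep_vars_sum\<close> applies to one
    variable and the sum of the others.\<close>
  have "indep_vars (\<lambda>_. borel) (\<lambda>j \<omega>. real (X j \<omega>)) (insert i I)"
    by (rule indep_vars_compose2[OF insert.prems(1)]) auto
  then have ind: "indep_var borel (\<lambda>\<omega>. real (X i \<omega>)) borel (\<lambda>\<omega>. \<Sum>j\<in>I. real (X j \<omega>))"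
    by (rule indep_vars_sum[OF insert.hyps])
  have AB: "prob (A a \<inter> B b) = prob (A a) * prob (B b)" for a b
  proof -
    have "prob ((\<lambda>\<omega>. (real (X i \<omega>), \<Sum>j\<in>I. real (X j \<omega>))) -` ({real a} \<times> {real b}) \<inter> space M)
      = prob ((\<lambda>\<omega>. real (X i \<omega>)) -` {real a} \<inter> space M) * prob ((\<lambda>\<omega>. \<Sum>j\<in>I. real (X j \<omega>)) -` {real b} \<inter> space M)"
      by (rule indep_varD[OF ind]) auto
    moreover have "(\<lambda>\<omega>. (real (X i \<omega>), \<Sum>j\<in>I. real (X j \<omega>))) -` ({real a} \<times> {real b}) \<inter> space M = A a \<inter> B b"
      by (auto simp: A_def B_def S_def simp flip: of_nat_sum)
    moreover have "(\<lambda>\<omega>. real (X i \<omega>)) -` {real a} \<inter> space M = A a" by (auto simp: A_def)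
    moreover have "(\<lambda>\<omega>. \<Sum>j\<in>I. real (X j \<omega>)) -` {real b} \<inter> space M = B b"
      by (auto simp: B_def S_def simp flip: of_nat_sum)
    ultimately show ?thesis by simp
  qed
  have rv: "random_variable (count_space UNIV) (X j)" if "j \<in> insert i I" for j
    using insert.prems(1) that by (auto simp: indep_vars_def)
  have A: "A a \<in> events" for a
    unfolding A_def using rv[of i] by measurable
  have "S \<in> measurable M (count_space UNIV)"
    unfolding S_def using rv by (intro measurable_sum_nat) auto
  then have B: "B b \<in> events" for b
    unfolding B_def by measurable
  define E where "E = {\<omega> \<in> space M. X i \<omega> + S \<omega> = k}"
  have "E = (\<Union>a\<in>{..k}. A a \<inter> B (k - a))" by (auto simp: E_def A_def B_def)
  then have E: "E \<in> events" using A B by auto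
  \<comment> \<open>\<open>X i\<close> may take values other than 0 and 1, but only on a null set,
    since the two probabilities add up to 1.\<close>
  have "prob (A 0 \<union> A 1) = prob (A 0) + prob (A 1)"
    using A by (intro finite_measure_Union) (auto simp: A_def)
  then have "prob (A 0 \<union> A 1) = 1" using insert.prems(2,3)[of i] by (simp add: A_def)
  then have ae: "AE \<omega> in M. \<omega> \<in> A 0 \<union> A 1" using A by (intro AE_prob_1)
  have "prob E = prob ((E \<inter> A 0) \<union> (E \<inter> A 1))"
    using ae A E by (intro finite_measure_eq_AE) auto
  also have "\<dots> = prob (E \<inter> A 0) + prob (E \<inter> A 1)"
    using A E by (intro finite_measure_Union) (auto simp: A_def)
  also have "E \<inter> A 0 = A 0 \<inter> B k" by (auto simp: E_def A_def B_def)
  \<comment> \<open>The case \<open>k = 0\<close> is separate because \<open>k - 1\<close> is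
    truncated to 0 there, while the event is empty.\<close>
  also have "E \<inter> A 1 = (if k = 0 then {} else A 1 \<inter> B (k - 1))" by (auto simp: E_def A_def B_def)
  also have "prob (A 0 \<inter> B k) + prob (if k = 0 then {} else A 1 \<inter> B (k - 1))
      = coeff ([:1 - p i, p i:] * (\<Prod>i\<in>I. [:1 - p i, p i:])) k"
    using insert.prems(2,3)[of i] by (cases k) (simp_all add: AB IH, simp_all add: A_def)
  finally show ?case using insert.hyps by (simp add: E_def S_def)
qed

section \<open>Comparison with the Poisson law\<close>

text \<open>Both \<open>1 + p \<le> exp p\<close> and \<open>1 - p \<le> exp (- p)\<close> enter:
  they place \<open>(1 - p) * exp p\<close> between 1 - p^2 and 1.\<close>

lemma one_minus_le_exp_minus_squared:
  fixes p :: real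
  assumes "0 \<le> p" "p \<le> 1"
  shows "\<bar>1 - (1 - p) * exp p\<bar> \<le> p\<^sup>2"
proof -
  have "(1 - p) * (1 + p) \<le> (1 - p) * exp p"
    using assms by (intro mult_left_mono exp_ge_add_one_self) auto
  moreover have "(1 - p) * exp p \<le> exp (- p) * exp p"
    using exp_ge_add_one_self[of "- p"] by (intro mult_right_mono) auto
  ultimately show ?thesis by (simp add: exp_minus power2_eq_square algebra_simps)
qed

text \<open>This is the case \<open>k = 0\<close>. After multiplication by the exponential of the
  sum, all factors \<open>(1 - p i) * exp (p i)\<close> lie in [0, 1] and are compared with 1;
  multiplying back yields the factor \<open>exp (- (\<Sum>i\<in>I. p i))\<close>.\<close>

lemma abs_prod_one_minus_minus_exp_le:
  fixes p :: "'i \<Rightarrow> real"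
  assumes "finite I" "\<And>i. i \<in> I \<Longrightarrow> 0 \<le> p i \<and> p i \<le> 1"
  shows "\<bar>(\<Prod>i\<in>I. 1 - p i) - exp (- (\<Sum>i\<in>I. p i))\<bar> \<le> (\<Sum>i\<in>I. (p i)\<^sup>2) * exp (- (\<Sum>i\<in>I. p i))"
proof -
  have le1: "(1 - p i) * exp (p i) \<le> 1" for i
    using mult_right_mono[OF exp_ge_add_one_self[of "- p i"], of "exp (p i)"] by (simp add: exp_minus)
  have "norm ((\<Prod>i\<in>I. 1) - (\<Prod>i\<in>I. (1 - p i) * exp (p i))) \<le> (\<Sum>i\<in>I. norm (1 - (1 - p i) * exp (p i)))"
    using assms(2) le1 by (intro norm_prod_diff) auto
  also have "\<dots> \<le> (\<Sum>i\<in>I. (p i)\<^sup>2)"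
    using assms(2) one_minus_le_exp_minus_squared by (intro sum_mono) auto
  finally have "\<bar>1 - (\<Prod>i\<in>I. 1 - p i) * exp (\<Sum>i\<in>I. p i)\<bar> \<le> (\<Sum>i\<in>I. (p i)\<^sup>2)"
    using assms(1) by (simp add: prod.distrib exp_sum)
  then have "\<bar>1 - (\<Prod>i\<in>I. 1 - p i) * exp (\<Sum>i\<in>I. p i)\<bar> * exp (- (\<Sum>i\<in>I. p i))
      \<le> (\<Sum>i\<in>I. (p i)\<^sup>2) * exp (- (\<Sum>i\<in>I. p i))"
    by (rule mult_right_mono) simp
  moreover have "\<bar>1 - (\<Prod>i\<in>I. 1 - p i) * exp (\<Sum>i\<in>I. p i)\<bar> * exp (- (\<Sum>i\<in>I. p i))
      = \<bar>(1 - (\<Prod>i\<in>I. 1 - p i) * exp (\<Sum>i\<in>I. p i)) * exp (- (\<Sum>i\<in>I. p i))\<bar>"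
    by (simp add: abs_mult)
  moreover have "(1 - (\<Prod>i\<in>I. 1 - p i) * exp (\<Sum>i\<in>I. p i)) * exp (- (\<Sum>i\<in>I. p i))
      = exp (- (\<Sum>i\<in>I. p i)) - (\<Prod>i\<in>I. 1 - p i)"
    by (simp add: left_diff_distrib exp_minus)
  ultimately show ?thesis by (simp add: abs_minus_commute)
qed

text \<open>Half of 14 is the constant 7 of the local bound.\<close>

lemma exp_five_halves_le: "exp (5/2 :: real) \<le> 14"
proof -
  have "(exp (5/2 :: real))\<^sup>2 = exp 1 ^ 5"
    by (simp add: exp_double[symmetric] exp_of_nat_mult[symmetric])
  also have "\<dots> \<le> (272/100) ^ 5" using e_less_272 by (intro power_mono) auto
  also have "\<dots> \<le> 14\<^sup>2" by (simp add: power_divide)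
  finally show ?thesis by (rule power2_le_imp_le) simp
qed

text \<open>At \<open>r = 1\<close> the term with \<open>r - 1\<close> vanishes and the prefactors
  depending on \<open>r\<close> become 1. What remains is at most
  \<open>L2 * exp (1/2)\<close>.\<close>

lemma poisson_binomial_uniform_bound:
  fixes p :: "'i \<Rightarrow> real"
  assumes "finite I" and p: "\<And>i. i \<in> I \<Longrightarrow> 0 \<le> p i \<and> p i \<le> 1"
  defines "L \<equiv> (\<Sum>i\<in>I. p i)" and "L2 \<equiv> (\<Sum>i\<in>I. (p i)\<^sup>2)"
  shows "\<bar>coeff (\<Prod>i\<in>I. [:1 - p i, p i:]) k - L ^ k / fact k * exp (- L)\<bar> \<le> 3 * L2"
proof -
  define J where "J = integral {0..1} (\<lambda>t. (sin (pi * t))\<^sup>2 * exp (- 2 * (L - L2) * (sin (pi * t))\<^sup>2))"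
  have "L2 \<le> L" unfolding L_def L2_def
    using p by (intro sum_mono) (auto simp: power2_eq_square mult_left_le)
  then have J: "J \<le> 1/2" using integral_sin_exp_sin_le_half[of "L - L2"] by (simp add: J_def)
  have L2: "0 \<le> L2" by (simp add: L2_def sum_nonneg)
  have "\<bar>coeff (\<Prod>i\<in>I. [:1 - p i, p i:]) k - L ^ k / fact k * exp (- L)\<bar> \<le> 2 * L2 * exp (1/2) * J"
    using poisson_binomial_coeff_bound[where k=k and p=p, OF assms(1) p zero_less_one] by (simp add: L_def L2_def J_def mult_ac)
  also have "\<dots> \<le> 2 * L2 * exp (1/2) * (1/2)"
    using J L2 by (intro mult_left_mono) auto
  also have "\<dots> = L2 * exp (1/2)" by simp
  also have "\<dots> \<le> L2 * 3"
    using L2 exp_le by (intro mult_left_mono order_trans[of "exp (1/2)" "exp 1" 3]) auto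
  finally show ?thesis by simp
qed

text \<open>The radius \<open>k / L\<close> minimises \<open>exp (L * (r - 1)) / r ^ k\<close>; the
  minimum exceeds the Poisson weight \<open>q\<close> only by the Stirling factor, at most
  \<open>exp 1 * sqrt k\<close>.\<close>

lemma poisson_binomial_local_bound:
  fixes p :: "'i \<Rightarrow> real"
  assumes "finite I" and p: "\<And>i. i \<in> I \<Longrightarrow> 0 \<le> p i \<and> p i \<le> 1" and "k \<ge> 1"
  defines "L \<equiv> (\<Sum>i\<in>I. p i)" and "L2 \<equiv> (\<Sum>i\<in>I. (p i)\<^sup>2)"
  defines "\<rho> \<equiv> (L - L2) * min (real k / L) (L / real k)" and "q \<equiv> L ^ k / fact k * exp (- L)"
  assumes L: "L > 0"
  shows "\<bar>coeff (\<Prod>i\<in>I. [:1 - p i, p i:]) k - q\<bar>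
    \<le> 7 * sqrt (real k) * ((real k - L) / L)\<^sup>2 * L2 * min_one_neg_powr \<rho> (1/2) * q
      + 21 * real k powr (3/2) * (L2 / L) * min_one_neg_powr \<rho> (3/2) * q"
proof -
  define r where "r = real k / L"
  define m1 where "m1 = min_one_neg_powr \<rho> (1/2)"
  define m3 where "m3 = min_one_neg_powr \<rho> (3/2)"
  define R where "R = (r - 1)\<^sup>2 * m1 + 2 * r * m3"
  have r: "r > 0" using L assms(3) by (simp add: r_def)
  have q: "q \<ge> 0" using L by (simp add: q_def)
  have "L2 \<le> L" unfolding L_def L2_def
    using p by (intro sum_mono) (auto simp: power2_eq_square mult_left_le)
  then have rho: "\<rho> \<ge> 0" using L by (simp add: \<rho>_def)
  have rho_eq: "\<rho> = (L - L2) * min r (1 / r)" by (simp add: \<rho>_def r_def)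
  have L2: "0 \<le> L2" by (simp add: L2_def sum_nonneg)
  have m: "m1 \<ge> 0" "m3 \<ge> 0" by (simp_all add: m1_def m3_def min_one_neg_powr_def)
  have R: "R \<ge> 0" using m r by (simp add: R_def)
  have "\<bar>coeff (\<Prod>i\<in>I. [:1 - p i, p i:]) k - q\<bar>
    \<le> exp (L * (r - 1)) / r ^ k * L2 * (exp (1/2) / 2 * exp (max 0 (1 - r))) *
      ((r - 1)\<^sup>2 * integral {0..1} (\<lambda>t. exp (- 2 * \<rho> * (sin (pi * t))\<^sup>2)) +
       4 * r * integral {0..1} (\<lambda>t. (sin (pi * t))\<^sup>2 * exp (- 2 * \<rho> * (sin (pi * t))\<^sup>2)))"
    using poisson_binomial_coeff_bound[where k=k and p=p, OF assms(1) p r]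
    unfolding q_def rho_eq L_def L2_def by simp
  also have "\<dots> \<le> exp (L * (r - 1)) / r ^ k * L2 * (exp (1/2) / 2 * exp (max 0 (1 - r))) *
      ((r - 1)\<^sup>2 * m1 + 4 * r * (1/2 * m3))"
    unfolding m1_def m3_def using r L2 rho
    by (intro mult_left_mono add_mono integral_exp_sin_le_min integral_sin_exp_sin_le_min) auto
  also have "\<dots> = exp (L * (r - 1)) / r ^ k * L2 * (exp (1/2) / 2 * exp (max 0 (1 - r))) * R"
    by (simp add: R_def)
  \<comment> \<open>One factor \<open>exp 1\<close> comes from the factorial bound, the other from
    \<open>exp (max 0 (1 - r))\<close> with \<open>r > 0\<close>; with \<open>exp (1/2)\<close> they
    make \<open>exp (5/2)\<close>.\<close>
  also have "\<dots> \<le> (exp 1 * sqrt (real k) * q) * L2 * (exp (1/2) / 2 * exp 1) * R"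
  proof (intro mult_right_mono mult_mono mult_left_mono)
    have "fact k * exp (real k) \<le> exp 1 * sqrt (real k) * real k ^ k"
      using mult_right_mono[OF fact_le_exp_sqrt_power[OF assms(3)], of "exp (real k)"]
      by (simp add: mult.assoc flip: exp_add)
    then have le: "fact k * exp (real k) * (L ^ k / (real k ^ k * fact k * exp L))
      \<le> exp 1 * sqrt (real k) * real k ^ k * (L ^ k / (real k ^ k * fact k * exp L))"
      using L by (intro mult_right_mono) auto
    have "L * (r - 1) = real k - L" using L by (simp add: r_def right_diff_distrib)
    then have "exp (L * (r - 1)) / r ^ k = fact k * exp (real k) * (L ^ k / (real k ^ k * fact k * exp L))"
      by (simp add: r_def exp_diff power_divide)
    moreover have "exp 1 * sqrt (real k) * real k ^ k * (L ^ k / (real k ^ k * fact k * exp L))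
        = exp 1 * sqrt (real k) * q"
      using assms(3) by (simp add: q_def exp_minus divide_inverse)
    ultimately show "exp (L * (r - 1)) / r ^ k \<le> exp 1 * sqrt (real k) * q"
      using le by simp
  qed (use r L2 R q in auto)
  also have "\<dots> = exp (5/2) / 2 * (sqrt (real k) * q * L2 * R)"
  proof -
    have "exp (5/2 :: real) = exp 1 * exp (1/2) * exp 1" by (simp flip: exp_add)
    then show ?thesis by simp
  qed
  also have "\<dots> \<le> 7 * (sqrt (real k) * q * L2 * R)"
    using exp_five_halves_le q L2 R by (intro mult_right_mono) auto
  also have "\<dots> = 7 * sqrt (real k) * (r - 1)\<^sup>2 * L2 * m1 * q + 14 * (sqrt (real k) * r) * L2 * m3 * q"
    by (simp add: R_def algebra_simps)
  \<comment> \<open>The argument gives 14 here, which is relaxed to the 21 of the claim.\<close>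
  also have "\<dots> \<le> 7 * sqrt (real k) * (r - 1)\<^sup>2 * L2 * m1 * q + 21 * (sqrt (real k) * r) * L2 * m3 * q"
    using r L2 q m by (intro add_left_mono mult_right_mono) auto
  also have "sqrt (real k) * r = real k powr (3/2) / L"
    using assms(3) powr_add[of "real k" 1 "1/2"] by (simp add: r_def powr_half_sqrt)
  also have "r - 1 = (real k - L) / L"
    using L by (simp add: r_def field_simps)
  finally show ?thesis by (simp add: m1_def m3_def)
qed

theorem theorem1p3:
  fixes M :: "'a measure" and N :: "'b measure"
    and n :: nat and p :: "nat \<Rightarrow> real"
    and X :: "nat \<Rightarrow> 'a \<Rightarrow> nat" and W :: "'a \<Rightarrow> nat" and Z :: "'b \<Rightarrow> nat"
    and lam lam2 :: real and \<Delta> \<rho> :: "nat \<Rightarrow> real"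
  assumes "prob_space M" and "prob_space N"
    and "n \<ge> 1"
    and "\<And>j. j \<in> {1..n} \<Longrightarrow> p j \<in> {0..1}"
    and "lam = (\<Sum>j=1..n. p j)" and "lam > 0"
    and "lam2 = (\<Sum>j=1..n. (p j)\<^sup>2)"
    and "prob_space.indep_vars M (\<lambda>_. count_space UNIV) X {1..n}"
    and "\<And>j. j \<in> {1..n} \<Longrightarrow> measure M {\<omega> \<in> space M. X j \<omega> = 1} = p j"
    and "\<And>j. j \<in> {1..n} \<Longrightarrow> measure M {\<omega> \<in> space M. X j \<omega> = 0} = 1 - p j"
    and "\<And>\<omega>. W \<omega> = (\<Sum>j=1..n. X j \<omega>)"
    and "Z \<in> measurable N (count_space UNIV)"
    and "distr N (count_space UNIV) Z = measure_pmf (poisson_pmf lam)"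
    and "\<And>k. \<Delta> k = measure M {\<omega> \<in> space M. W \<omega> = k} - measure N {\<omega> \<in> space N. Z \<omega> = k}"
    and "\<And>k. k \<ge> 1 \<Longrightarrow> \<rho> k = (lam - lam2) * min (real k / lam) (lam / real k)"
  shows "\<bar>\<Delta> 0\<bar> \<le> 3 * lam2 * exp (- lam)
    \<and> (\<forall>k\<ge>1. \<bar>\<Delta> k\<bar> \<le> 3 * lam2)
    \<and> (\<forall>k\<ge>1. \<bar>\<Delta> k\<bar> \<le>
          7 * sqrt (real k) * ((real k - lam) / lam)\<^sup>2 * lam2 * min_one_neg_powr (\<rho> k) (1/2)
            * measure N {\<omega> \<in> space N. Z \<omega> = k}
        + 21 * real k powr (3/2) * (lam2 / lam) * min_one_neg_powr (\<rho> k) (3/2)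
            * measure N {\<omega> \<in> space N. Z \<omega> = k})"
proof -
  interpret M: prob_space M by fact
  define D where "D = (\<lambda>k. coeff (\<Prod>j=1..n. [:1 - p j, p j:]) k - lam ^ k / fact k * exp (- lam))"
  have p: "0 \<le> p j \<and> p j \<le> 1" if "j \<in> {1..n}" for j using assms(4)[OF that] by simp
  have W: "measure M {\<omega> \<in> space M. W \<omega> = k} = coeff (\<Prod>j=1..n. [:1 - p j, p j:]) k" for k
    unfolding assms(11) using assms(8-10) by (intro M.prob_sum_bernoulli) auto
  have Z: "measure N {\<omega> \<in> space N. Z \<omega> = k} = lam ^ k / fact k * exp (- lam)" for k
  proof -
    have "measure N {\<omega> \<in> space N. Z \<omega> = k} = measure (distr N (count_space UNIV) Z) {k}"
      using assms(12) by (subst measure_distr) (auto intro: arg_cong[where f="measure N"])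
    also have "\<dots> = pmf (poisson_pmf lam) k" unfolding assms(13) by (simp add: pmf.rep_eq)
    finally show ?thesis using assms(6) by simp
  qed
  have D: "\<Delta> k = D k" for k unfolding assms(14) D_def W Z ..
  \<comment> \<open>The constant coefficient of the product is its value at 0.\<close>
  have "D 0 = (\<Prod>j=1..n. 1 - p j) - exp (- lam)"
    by (simp add: D_def poly_0_coeff_0[symmetric] poly_prod)
  then have "\<bar>D 0\<bar> \<le> lam2 * exp (- lam)"
    using abs_prod_one_minus_minus_exp_le[of "{1..n}" p] p assms(5,7) by simp
  moreover have "0 \<le> lam2" by (simp add: assms(7) sum_nonneg)
  ultimately have "\<bar>\<Delta> 0\<bar> \<le> 3 * lam2 * exp (- lam)"
    using mult_right_mono[of lam2 "3 * lam2" "exp (- lam)"] by (simp add: D)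
  moreover have "\<bar>\<Delta> k\<bar> \<le> 3 * lam2" for k
    using poisson_binomial_uniform_bound[of "{1..n}" p k] p by (simp add: D D_def assms(5,7))
  moreover have "\<bar>\<Delta> k\<bar> \<le>
          7 * sqrt (real k) * ((real k - lam) / lam)\<^sup>2 * lam2 * min_one_neg_powr (\<rho> k) (1/2)
            * measure N {\<omega> \<in> space N. Z \<omega> = k}
        + 21 * real k powr (3/2) * (lam2 / lam) * min_one_neg_powr (\<rho> k) (3/2)
            * measure N {\<omega> \<in> space N. Z \<omega> = k}" if "k \<ge> 1" for k
    unfolding Z D D_def assms(15)[OF that] unfolding assms(5,7)
    by (rule poisson_binomial_local_bound) (use p that assms(5,6) in auto)
  ultimately show ?thesis by blast
qed

end
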